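(* Let $X$ be a finite set, and let the edges of the complete graph on $X$ be coloured red, green and blue in any manner whatever. Then there are a finite commutative ring $A$ with unity and an embedding (injective map) $\theta$ of $X$ into $A^2$ such that, for all distinct $v,w\in X$: (i) if $\{v,w\}$ is red, then $\{\theta(v),\theta(w)\}$ is an edge of the zero-divisor graph of $A^2$; (ii) if $\{v,w\}$ is green, then $\{\theta(v),\theta(w)\}$ is an edge of the $2$-dimensional dot product graph of $A$ but not an edge of the zero-divisor graph of $A^2$; (iii) if $\{v,w\}$ is blue, then $\{\theta(v),\theta(w)\}$ is not an edge of the $2$-dimensional dot product graph of $A$.
   Context: Rings are finite commutative rings with unity; graphs are finite simple undirected graphs. In this statement, the zero-divisor graph of a ring $B$ has as vertices all non-zero elements of $B$, two distinct vertices $a,b$ being joined if and only if $ab=0$ (vertices are not restricted to zero-divisors). For a positive integer $m$, $A^m$ is a ring with componentwise operations, in particular with product $a*b=(a_1b_1,a_2b_2,\ldots,a_mb_m)$. The $m$-dimensional dot product graph of $A$ has as vertices all non-zero elements of $A^m$, two distinct vertices $a=(a_1,\ldots,a_m)$ and $b=(b_1,\ldots,b_m)$ being joined if and only if $a\cdot b=0$, where $a\cdot b=a_1b_1+a_2b_2+\cdots+a_mb_m$. *)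

theory Defs
  imports "HOL-Algebra.Chinese_Remainder"
begin

datatype colour = Red | Green | Blue

text \<open>A simple graph is a pair of a vertex set and a set of two-element edges.\<close>

type_synonym 'a graph = "'a set \<times> 'a set set"

abbreviation vertices :: "'a graph \<Rightarrow> 'a set" where
  "vertices \<equiv> fst"

abbreviation edges :: "'a graph \<Rightarrow> 'a set set" where
  "edges \<equiv> snd"

text \<open>The ring \<open>A\<^sup>m\<close>. Its elements are lists of length \<open>m\<close>; the operations are componentwise on the carrier by the lemmas below.\<close>

definition ring_power :: "('a, 'n) ring_scheme \<Rightarrow> nat \<Rightarrow> 'a list ring" where
  "ring_power A m = RDirProd_list (replicate m A)"

lemma ring_power_carrier:
  "carrier (ring_power A m) = {a. length a = m \<and> set a \<subseteq> carrier A}"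
proof (intro subset_antisym subsetI)
  fix a assume "a \<in> carrier (ring_power A m)"
  then have "length a = m" "\<And>i. i < m \<Longrightarrow> a ! i \<in> carrier A"
    using RDirProd_list_carrier_mem[of a "replicate m A"] by (auto simp: ring_power_def)
  then show "a \<in> {a. length a = m \<and> set a \<subseteq> carrier A}"
    by (auto simp: in_set_conv_nth)
next
  fix a assume "a \<in> {a. length a = m \<and> set a \<subseteq> carrier A}"
  then show "a \<in> carrier (ring_power A m)"
    unfolding ring_power_def by (intro RDirProd_list_carrier_memI) (auto simp: subset_iff)
qed

lemma ring_power_zero: "\<zero>\<^bsub>ring_power A m\<^esub> = replicate m \<zero>\<^bsub>A\<^esub>"
  unfolding ring_power_def RDirProd_list_zero by (induction m) simp_all

lemma ring_power_one: "\<one>\<^bsub>ring_power A m\<^esub> = replicate m \<one>\<^bsub>A\<^esub>"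
  unfolding ring_power_def RDirProd_list_one by (induction m) simp_all

lemma ring_power_add_mult:
  assumes "a \<in> carrier (ring_power A m)" "b \<in> carrier (ring_power A m)"
  shows "a \<oplus>\<^bsub>ring_power A m\<^esub> b = map2 (\<oplus>\<^bsub>A\<^esub>) a b \<and>
         a \<otimes>\<^bsub>ring_power A m\<^esub> b = map2 (\<otimes>\<^bsub>A\<^esub>) a b"
  using assms
proof (induction m arbitrary: a b)
  case 0
  then show ?case
    by (simp add: ring_power_carrier) (simp add: ring_power_def RDirProd_list_def monoid.defs)
next
  case (Suc m)
  obtain x xs y ys where ab: "a = x # xs" "b = y # ys"
    and x: "x \<in> carrier A" "xs \<in> carrier (ring_power A m)"
    and y: "y \<in> carrier A" "ys \<in> carrier (ring_power A m)"
    using Suc.prems by (fastforce simp: ring_power_carrier length_Suc_conv)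
  have hom: "(\<lambda>(a, as). a # as) \<in> ring_hom (RDirProd A (ring_power A m)) (ring_power A (Suc m))"
    using RDirProd_list_hom1[of A "replicate m A"] by (simp add: ring_power_def)
  have mem: "(x, xs) \<in> carrier (RDirProd A (ring_power A m))"
    "(y, ys) \<in> carrier (RDirProd A (ring_power A m))"
    using x y by (simp_all add: RDirProd_carrier)
  have "(x, xs) \<oplus>\<^bsub>RDirProd A (ring_power A m)\<^esub> (y, ys) =
      (x \<oplus>\<^bsub>A\<^esub> y, xs \<oplus>\<^bsub>ring_power A m\<^esub> ys)"
    "(x, xs) \<otimes>\<^bsub>RDirProd A (ring_power A m)\<^esub> (y, ys) =
      (x \<otimes>\<^bsub>A\<^esub> y, xs \<otimes>\<^bsub>ring_power A m\<^esub> ys)"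
    by (simp_all add: RDirProd_def DirProd_def monoid.defs)
  then show ?case
    using ring_hom_add[OF hom mem] ring_hom_mult[OF hom mem] Suc.IH[OF x(2) y(2)]
    by (simp add: ab)
qed

definition zero_divisor_graph :: "('a, 'n) ring_scheme \<Rightarrow> 'a graph" where
  "zero_divisor_graph B =
    (carrier B - {\<zero>\<^bsub>B\<^esub>},
     {{a, b} | a b. a \<in> carrier B - {\<zero>\<^bsub>B\<^esub>} \<and> b \<in> carrier B - {\<zero>\<^bsub>B\<^esub>} \<and> a \<noteq> b \<and>
        a \<otimes>\<^bsub>B\<^esub> b = \<zero>\<^bsub>B\<^esub>})"

definition dot_product :: "('a, 'n) ring_scheme \<Rightarrow> nat \<Rightarrow> 'a list \<Rightarrow> 'a list \<Rightarrow> 'a" where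
  "dot_product A m a b = (\<Oplus>\<^bsub>A\<^esub>i\<in>{..<m}. a ! i \<otimes>\<^bsub>A\<^esub> b ! i)"

definition dot_product_graph :: "('a, 'n) ring_scheme \<Rightarrow> nat \<Rightarrow> 'a list graph" where
  "dot_product_graph A m =
    (carrier (ring_power A m) - {\<zero>\<^bsub>ring_power A m\<^esub>},
     {{a, b} | a b. a \<in> carrier (ring_power A m) - {\<zero>\<^bsub>ring_power A m\<^esub>} \<and>
        b \<in> carrier (ring_power A m) - {\<zero>\<^bsub>ring_power A m\<^esub>} \<and> a \<noteq> b \<and>
        dot_product A m a b = \<zero>\<^bsub>A\<^esub>})"

end

theory Submission
  imports Defs
begin

text \<open>
  The ring is a finite Boolean ring of subsets of a ground set \<open>Y\<close>, where products are
  intersections and sums are symmetric differences. Take for \<open>Y\<close> the subsets of \<open>X\<close>, and let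
  \<open>\<theta> v = (P, Q)\<close>, where \<open>P\<close> consists of \<open>{v}\<close> and the non-red edges at \<open>v\<close>, and \<open>Q\<close> of the green
  edges at \<open>v\<close>. For distinct \<open>v\<close>, \<open>w\<close> both products are subsets of \<open>{{v, w}}\<close>: they are both empty
  if the edge is red, both equal to \<open>{{v, w}}\<close> (hence cancel in characteristic 2) if it is green,
  and only the first is nonempty if it is blue. The points \<open>{v}\<close> make \<open>\<theta>\<close> injective and nonzero.
  Subsets are encoded as natural numbers by their binary digits.
\<close>

unbundle bit_operations_syntax

text \<open>The carrier is described by bits rather than as \<open>m < 2 ^ n\<close>, so that
  closure and the ring laws can be checked bit by bit.\<close>

definition bit_ring :: "nat \<Rightarrow> nat ring" where
  "bit_ring n = \<lparr>carrier = {m. \<forall>i. bit m i \<longrightarrow> i < n}, mult = (AND), one = mask n, zero = 0, add = (XOR)\<rparr>"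

lemma bit_ring_simps [simp]:
  "m \<in> carrier (bit_ring n) \<longleftrightarrow> (\<forall>i. bit m i \<longrightarrow> i < n)"
  "x \<otimes>\<^bsub>bit_ring n\<^esub> y = x AND y"
  "x \<oplus>\<^bsub>bit_ring n\<^esub> y = x XOR y"
  "\<zero>\<^bsub>bit_ring n\<^esub> = 0"
  "\<one>\<^bsub>bit_ring n\<^esub> = mask n"
  by (simp_all add: bit_ring_def)

lemma finite_carrier_bit_ring: "finite (carrier (bit_ring n))"
proof (rule finite_subset)
  show "carrier (bit_ring n) \<subseteq> {..<2 ^ n}"
  proof
    fix m assume "m \<in> carrier (bit_ring n)"
    \<comment> \<open>No bit lies at position \<open>n\<close> or above, so truncation changes
      nothing.\<close>
    then have "take_bit n m = m"
      by (auto intro!: bit_eqI simp: bit_take_bit_iff)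
    then show "m \<in> {..<2 ^ n}"
      by (metis lessThan_iff take_bit_nat_less_exp)
  qed
qed simp

lemma cring_bit_ring: "cring (bit_ring n)"
proof (rule cringI)
  show "abelian_group (bit_ring n)"
  proof (rule abelian_groupI)
    fix x assume "x \<in> carrier (bit_ring n)"
    \<comment> \<open>In characteristic 2 every element is its own negative.\<close>
    then show "\<exists>y\<in>carrier (bit_ring n). y \<oplus>\<^bsub>bit_ring n\<^esub> x = \<zero>\<^bsub>bit_ring n\<^esub>"
      by (intro bexI[of _ x]) auto
  qed (auto simp: bit_xor_iff ac_simps)
  show "comm_monoid (bit_ring n)"
    by (rule comm_monoidI)
      (auto simp: bit_and_iff bit_mask_iff ac_simps intro!: bit_eqI)
qed (auto simp: bit_and_iff bit_xor_iff intro!: bit_eqI)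

text \<open>Each insertion sets one more bit. This turns finite sets of edge numbers into ring
  elements.\<close>

lemma ex_nat_bits:
  assumes "finite S"
  shows "\<exists>m::nat. \<forall>i. bit m i \<longleftrightarrow> i \<in> S"
  using assms
proof induction
  case (insert j S)
  then obtain m :: nat where "\<And>i. bit m i \<longleftrightarrow> i \<in> S" by blast
  then show ?case
    by (intro exI[of _ "set_bit j m"]) (auto simp: bit_set_bit_iff)
qed (auto intro!: exI[of _ 0])

text \<open>An edge is an unordered pair, so it may match the definition in either order;
  commutativity makes the two resulting conditions agree.\<close>

lemma edge_zero_divisor_graph_power2_iff:
  fixes A (structure)
  assumes "cring A" "x \<in> carrier A" "x' \<in> carrier A" "y \<in> carrier A" "y' \<in> carrier A"
    and "[x, x'] \<noteq> [\<zero>\<^bsub>A\<^esub>, \<zero>\<^bsub>A\<^esub>]" "[y, y'] \<noteq> [\<zero>\<^bsub>A\<^esub>, \<zero>\<^bsub>A\<^esub>]" "[x, x'] \<noteq> [y, y']"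
  shows "{[x, x'], [y, y']} \<in> edges (zero_divisor_graph (ring_power A 2)) \<longleftrightarrow>
    x \<otimes>\<^bsub>A\<^esub> y = \<zero>\<^bsub>A\<^esub> \<and> x' \<otimes>\<^bsub>A\<^esub> y' = \<zero>\<^bsub>A\<^esub>"
proof -
  interpret cring A by fact
  let ?B = "ring_power A 2"
  have mem: "[x, x'] \<in> carrier ?B - {\<zero>\<^bsub>?B\<^esub>}" "[y, y'] \<in> carrier ?B - {\<zero>\<^bsub>?B\<^esub>}"
    using assms by (auto simp: ring_power_carrier ring_power_zero numeral_2_eq_2)
  have "[x, x'] \<otimes>\<^bsub>?B\<^esub> [y, y'] = \<zero>\<^bsub>?B\<^esub> \<longleftrightarrow> x \<otimes> y = \<zero> \<and> x' \<otimes> y' = \<zero>"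
    "[y, y'] \<otimes>\<^bsub>?B\<^esub> [x, x'] = \<zero>\<^bsub>?B\<^esub> \<longleftrightarrow> x \<otimes> y = \<zero> \<and> x' \<otimes> y' = \<zero>"
    using mem assms(2-5)
    by (simp_all add: ring_power_add_mult ring_power_zero numeral_2_eq_2 m_comm)
  then show ?thesis
    using mem assms(8) by (auto simp: zero_divisor_graph_def doubleton_eq_iff)
qed

lemma edge_dot_product_graph2_iff:
  fixes A (structure)
  assumes "cring A" "x \<in> carrier A" "x' \<in> carrier A" "y \<in> carrier A" "y' \<in> carrier A"
    and "[x, x'] \<noteq> [\<zero>\<^bsub>A\<^esub>, \<zero>\<^bsub>A\<^esub>]" "[y, y'] \<noteq> [\<zero>\<^bsub>A\<^esub>, \<zero>\<^bsub>A\<^esub>]" "[x, x'] \<noteq> [y, y']"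
  shows "{[x, x'], [y, y']} \<in> edges (dot_product_graph A 2) \<longleftrightarrow>
    x \<otimes>\<^bsub>A\<^esub> y \<oplus>\<^bsub>A\<^esub> x' \<otimes>\<^bsub>A\<^esub> y' = \<zero>\<^bsub>A\<^esub>"
proof -
  interpret cring A by fact
  let ?B = "ring_power A 2"
  have mem: "[x, x'] \<in> carrier ?B - {\<zero>\<^bsub>?B\<^esub>}" "[y, y'] \<in> carrier ?B - {\<zero>\<^bsub>?B\<^esub>}"
    using assms by (auto simp: ring_power_carrier ring_power_zero numeral_2_eq_2)
  have "dot_product A 2 [x, x'] [y, y'] = x \<otimes> y \<oplus> x' \<otimes> y'"
    "dot_product A 2 [y, y'] [x, x'] = x \<otimes> y \<oplus> x' \<otimes> y'"
    using assms(2-5)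
    by (simp_all add: dot_product_def numeral_2_eq_2 lessThan_Suc m_comm a_comm)
  then show ?thesis
    using mem assms(8) unfolding dot_product_graph_def snd_conv mem_Collect_eq doubleton_eq_iff by metis
qed

theorem theorem5p1:
  fixes X :: "'a set" and col :: "'a set \<Rightarrow> colour"
  assumes "finite X"
  shows "\<exists>(A :: nat ring) \<theta>.
    cring A \<and> finite (carrier A) \<and>
    \<theta> \<in> X \<rightarrow> carrier (ring_power A 2) \<and> inj_on \<theta> X \<and>
    (\<forall>v\<in>X. \<forall>w\<in>X. v \<noteq> w \<longrightarrow>
      (col {v, w} = Red \<longrightarrow> {\<theta> v, \<theta> w} \<in> edges (zero_divisor_graph (ring_power A 2))) \<and>
      (col {v, w} = Green \<longrightarrow> {\<theta> v, \<theta> w} \<in> edges (dot_product_graph A 2) \<and>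
        {\<theta> v, \<theta> w} \<notin> edges (zero_divisor_graph (ring_power A 2))) \<and>
      (col {v, w} = Blue \<longrightarrow> {\<theta> v, \<theta> w} \<notin> edges (dot_product_graph A 2)))"
proof -
  \<comment> \<open>\<open>g\<close> numbers the subsets of \<open>X\<close> by the bit positions
    below \<open>n\<close>; singletons and edges alike receive a position.\<close>
  obtain g :: "'a set \<Rightarrow> nat" and n where inj_g: "inj_on g (Pow X)" and g_less: "g ` Pow X = {i. i < n}"
    using finite_imp_inj_to_nat_seg[of "Pow X"] assms by (metis finite_Pow_iff)
  \<comment> \<open>\<open>P v\<close> and \<open>Q v\<close> collect second endpoints; the sets of
    the overview are their images under \<open>w\<close> \<mapsto> \<open>{v, w}\<close>. The case
    \<open>w = v\<close> in \<open>P v\<close> yields the point \<open>{v}\<close>.\<close>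
  define P where "P v = {w \<in> X. w = v \<or> col {v, w} \<noteq> Red}" for v
  define Q where "Q v = {w \<in> X. w \<noteq> v \<and> col {v, w} = Green}" for v
  have fin: "finite (P v)" "finite (Q v)" for v
    using assms by (auto simp: P_def Q_def)
  have "\<exists>m::nat. \<forall>i. bit m i \<longleftrightarrow> i \<in> (\<lambda>w. g {v, w}) ` P v" for v
    by (intro ex_nat_bits finite_imageI fin)
  then obtain p :: "'a \<Rightarrow> nat" where p: "\<And>v i. bit (p v) i \<longleftrightarrow> i \<in> (\<lambda>w. g {v, w}) ` P v"
    by metis
  have "\<exists>m::nat. \<forall>i. bit m i \<longleftrightarrow> i \<in> (\<lambda>w. g {v, w}) ` Q v" for v
    by (intro ex_nat_bits finite_imageI fin)
  then obtain q :: "'a \<Rightarrow> nat" where q: "\<And>v i. bit (q v) i \<longleftrightarrow> i \<in> (\<lambda>w. g {v, w}) ` Q v"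
    by metis
  have g_eq: "g e = g f \<longleftrightarrow> e = f" if "e \<subseteq> X" "f \<subseteq> X" for e f
    using inj_g that by (simp add: inj_on_eq_iff)
  have carr: "p v \<in> carrier (bit_ring n)" "q v \<in> carrier (bit_ring n)" if "v \<in> X" for v
    using g_less that by (auto simp: p q P_def Q_def)
  \<comment> \<open>\<open>{w, u} = {v}\<close> forces \<open>w = v\<close>, so the bit of
    \<open>{v}\<close> singles out \<open>p v\<close>.\<close>
  have loop: "bit (p w) (g {v, v}) \<longleftrightarrow> w = v" if "v \<in> X" "w \<in> X" for v w
    using that by (auto simp: p P_def g_eq image_iff intro!: exI[of _ v])
  have nz: "p v \<noteq> 0" if "v \<in> X" for v
    using loop[OF that that] by (metis bit_0_eq bot_apply bot_bool_def)
  have p_inj: "v = w" if "v \<in> X" "w \<in> X" "p v = p w" for v w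
    using loop[of v v] loop[of v w] that by auto
  \<comment> \<open>A common bit comes from a set containing both \<open>v\<close> and
    \<open>w\<close> with at most two elements, which can only be \<open>{v, w}\<close>.\<close>
  have pp: "bit (p v AND p w) i \<longleftrightarrow> col {v, w} \<noteq> Red \<and> i = g {v, w}"
    and qq: "bit (q v AND q w) i \<longleftrightarrow> col {v, w} = Green \<and> i = g {v, w}"
    if "v \<in> X" "w \<in> X" "v \<noteq> w" for v w i
    using that by (auto simp: bit_and_iff p q P_def Q_def g_eq doubleton_eq_iff insert_commute image_iff)
  have zero: "m = 0 \<longleftrightarrow> (\<forall>i. \<not> bit m i)" for m :: nat
    by (auto intro: bit_eqI)
  let ?A = "bit_ring n"
  let ?\<theta> = "\<lambda>v. [p v, q v]"
  have zd: "{?\<theta> v, ?\<theta> w} \<in> edges (zero_divisor_graph (ring_power ?A 2)) \<longleftrightarrow> col {v, w} = Red"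
    and dp: "{?\<theta> v, ?\<theta> w} \<in> edges (dot_product_graph ?A 2) \<longleftrightarrow> col {v, w} \<noteq> Blue"
    if vw: "v \<in> X" "w \<in> X" "v \<noteq> w" for v w
  proof -
    have neq: "?\<theta> v \<noteq> [\<zero>\<^bsub>?A\<^esub>, \<zero>\<^bsub>?A\<^esub>]" "?\<theta> w \<noteq> [\<zero>\<^bsub>?A\<^esub>, \<zero>\<^bsub>?A\<^esub>]" "?\<theta> v \<noteq> ?\<theta> w"
      using vw nz p_inj by auto
    note iff = edge_zero_divisor_graph_power2_iff edge_dot_product_graph2_iff
    note iff = iff[OF cring_bit_ring carr[OF vw(1)] carr[OF vw(2)] neq]
    show "{?\<theta> v, ?\<theta> w} \<in> edges (zero_divisor_graph (ring_power ?A 2)) \<longleftrightarrow> col {v, w} = Red"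
      unfolding iff(1) bit_ring_simps zero using pp[OF vw] qq[OF vw] by auto
    show "{?\<theta> v, ?\<theta> w} \<in> edges (dot_product_graph ?A 2) \<longleftrightarrow> col {v, w} \<noteq> Blue"
      \<comment> \<open>Only the bit at \<open>g {v, w}\<close> can survive in the sum, and it does
        so exactly when one product has it and the other does not, the blue case.\<close>
      unfolding iff(2) bit_ring_simps zero bit_xor_iff pp[OF vw] qq[OF vw]
      by (cases "col {v, w}") auto
  qed
  have "?\<theta> \<in> X \<rightarrow> carrier (ring_power ?A 2)"
    using carr by (auto simp: ring_power_carrier simp del: bit_ring_simps)
  moreover have "inj_on ?\<theta> X"
    using p_inj by (auto intro: inj_onI)
  ultimately show ?thesis
    using cring_bit_ring finite_carrier_bit_ring zd dp
    by (intro exI[of _ ?A] exI[of _ ?\<theta>]) simp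
qed

end
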